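(* Let $k,n\ge 2$ and $l\ge 1$ be integers, and let $d_1,\dots,d_l$ be positive integers with $\sum_{i=1}^l d_i<n+k$ (the degrees of the hypersurfaces cutting out a complete intersection $Y$ in the Grassmannian $\mathrm{Gr}(n,n+k)$). Let $B_1,\dots,B_l$ be the consecutive blocks of sizes $d_1,\dots,d_l$ of the quiver $\mathcal{Q}$, let $B_0=\mathrm{Ar}(\mathcal{Q})\setminus(B_1\cup\dots\cup B_l)$, and let $\widetilde{L}\subset \mathbb{T}(\widetilde{V})$ be the subvariety defined by the equations $$\widetilde{F}_{B_1}=\dots=\widetilde{F}_{B_l}=1 .$$ Then $\widetilde{L}$ is birational to a torus $\mathcal{Y}\cong(\mathbb{C}^* )^{nk-l}$, and the birational equivalence $\widetilde{\tau}\colon\mathcal{Y}\dashrightarrow\widetilde{L}$ can be chosen so that $\widetilde{\tau}^*\big(\widetilde{F}_{B_0}\big)$ is a regular function on $\mathcal{Y}$. In particular, this function is given by a Laurent polynomial.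
   Context: Everything is defined over $\mathbb{C}$. For integers $n_1,n_2$, $[n_1,n_2]$ denotes $\{i\in\mathbb{Z}\mid n_1\le i\le n_2\}$. Quiver. $\mathcal{Q}$ has vertex set $\{(i,j)\mid i\in[1,k],\, j\in[1,n]\}\cup\{(0,1),(k,n+1)\}$. Its set of arrows $\mathrm{Ar}(\mathcal{Q})$ consists of the vertical arrows $\mathbf{v}_{i,j}\colon(i,j)\to(i+1,j)$ for $i\in[1,k-1]$, $j\in[1,n]$; the horizontal arrows $\mathbf{h}_{i,j}\colon(i,j)\to(i,j+1)$ for $i\in[1,k]$, $j\in[1,n-1]$; the extra vertical arrow $\mathbf{v}_{0,1}\colon(0,1)\to(1,1)$; and the extra horizontal arrow $\mathbf{h}_{k,n}\colon(k,n)\to(k,n+1)$. For an arrow $\alpha$, $t(\alpha)$ and $h(\alpha)$ denote its tail (source) and head (target). Blocks. For $0\le r<s\le k$ the horizontal block $\mathrm{HB}(r,s)$ is the set of all vertical arrows $\mathbf{v}_{i,j}$ with $i\in[r,s-1]$; for $1\le r<s\le n+1$ the vertical block $\mathrm{VB}(r,s)$ is the set of all horizontal arrows $\mathbf{h}_{i,j}$ with $j\in[r,s-1]$; both have size $s-r$. The mixed block is $\mathrm{MB}(r,s)=\mathrm{HB}(r,k)\cup\mathrm{VB}(1,s)$ ($0\le r<k$, $1<s\le n+1$), of size $k-r+s-1$. Blocks $B_1,\dots,B_l$ are consecutive if they are successive pairwise disjoint blocks with $\mathbf{v}_{0,1}\in B_1$ and $B_1\cup\dots\cup B_p$ a block for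 every $p\in[1,l]$. Explicitly, the consecutive blocks of sizes $d_1,\dots,d_l$ are as follows: put $u_0=0$ and $u_p=d_1+\dots+d_p$; then $B_p=\mathrm{HB}(u_{p-1},u_p)$ if $u_p\le k$, $B_p=\mathrm{MB}(u_{p-1},u_p-k+1)$ if $u_{p-1}<k<u_p$, and $B_p=\mathrm{VB}(u_{p-1}-k+1,u_p-k+1)$ if $u_{p-1}\ge k$. Functions. $\widetilde{V}=\{\widetilde{a}_{i,j}\mid i\in[1,k],\,j\in[1,n]\}$ is a set of variables, and $\mathbb{T}(\widetilde{V})=\mathrm{Spec}\,\mathbb{C}[\widetilde{a}_{i,j}^{\pm1}]\cong(\mathbb{C}^* )^{nk}$. Put $\widetilde{a}_{0,1}=\widetilde{a}_{k,n+1}=1$. For a subset $A\subset\mathrm{Ar}(\mathcal{Q})$, $$\widetilde{F}_A=\sum_{\alpha\in A}\frac{\widetilde{a}_{h(\alpha)}}{\widetilde{a}_{t(\alpha)}},$$ a regular function on $\mathbb{T}(\widetilde{V})$. *)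

theory Defs
  imports
    "HOL-Analysis.Analysis"
    "HOL-Library.Poly_Mapping"
    "Graph_Theory.Digraph"
begin

section \<open>Laurent polynomials and tori\<close>

text \<open>
  A Laurent polynomial is an element of the group algebra over the complex numbers of the
  free abelian group of exponent vectors, i.e. a finitely supported map from exponent
  vectors to coefficients.
\<close>

type_synonym 'i laurent_poly = "('i \<Rightarrow>\<^sub>0 int) \<Rightarrow>\<^sub>0 complex"

definition laurent_polys :: "'i set \<Rightarrow> 'i laurent_poly set" where
  "laurent_polys I = {p. \<forall>m\<in>Poly_Mapping.keys p. Poly_Mapping.keys m \<subseteq> I}"

definition laurent_monom :: "('i \<Rightarrow>\<^sub>0 int) \<Rightarrow> ('i \<Rightarrow> complex) \<Rightarrow> complex" where
  "laurent_monom m x = (\<Prod>i\<in>Poly_Mapping.keys m. x i powi Poly_Mapping.lookup m i)"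

definition laurent_eval :: "'i laurent_poly \<Rightarrow> ('i \<Rightarrow> complex) \<Rightarrow> complex" where
  "laurent_eval p x = (\<Sum>m\<in>Poly_Mapping.keys p. Poly_Mapping.lookup p m * laurent_monom m x)"

text \<open>
  The closed points of the spectrum of the Laurent polynomial ring in the variables
  indexed by \<open>I\<close>. Points are extensional, so that equality of points is equality of
  the coordinates in \<open>I\<close>.
\<close>

definition torus :: "'i set \<Rightarrow> ('i \<Rightarrow> complex) set" where
  "torus I = (\<Pi>\<^sub>E i\<in>I. UNIV - {0})"

lemma laurent_monom_add:
  assumes "x \<in> torus I" "Poly_Mapping.keys m \<subseteq> I" "Poly_Mapping.keys m' \<subseteq> I"
  shows "laurent_monom (m + m') x = laurent_monom m x * laurent_monom m' x"
proof -
  let ?K = "Poly_Mapping.keys m \<union> Poly_Mapping.keys m'"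
  have *: "laurent_monom a x = (\<Prod>i\<in>?K. x i powi Poly_Mapping.lookup a i)"
    if "Poly_Mapping.keys a \<subseteq> ?K" for a
    unfolding laurent_monom_def using that
    by (intro prod.mono_neutral_left) (auto simp: in_keys_iff)
  have "x i powi (Poly_Mapping.lookup m i + Poly_Mapping.lookup m' i)
      = x i powi Poly_Mapping.lookup m i * x i powi Poly_Mapping.lookup m' i" if "i \<in> ?K" for i
    using that assms by (intro power_int_add) (auto simp: torus_def PiE_iff)
  then show ?thesis
    using Poly_Mapping.keys_add[of m m']
    by (simp add: * lookup_add prod.distrib)
qed

lemma laurent_eval_superset:
  assumes "finite K" "Poly_Mapping.keys p \<subseteq> K"
  shows "laurent_eval p x = (\<Sum>m\<in>K. Poly_Mapping.lookup p m * laurent_monom m x)"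
  unfolding laurent_eval_def using assms
  by (intro sum.mono_neutral_left) (auto simp: in_keys_iff)

lemma laurent_eval_0 [simp]: "laurent_eval 0 x = 0"
  by (simp add: laurent_eval_def)

lemma laurent_eval_single [simp]:
  "laurent_eval (Poly_Mapping.single m c) x = c * laurent_monom m x"
  by (simp add: laurent_eval_superset[of "{m}"])

lemma laurent_eval_1 [simp]: "laurent_eval 1 x = 1"
  using laurent_eval_single[of 0 1 x] by (simp add: laurent_monom_def)

lemma laurent_eval_add: "laurent_eval (p + q) x = laurent_eval p x + laurent_eval q x"
  by (simp add: laurent_eval_superset[of "Poly_Mapping.keys p \<union> Poly_Mapping.keys q"]
      Poly_Mapping.keys_add lookup_add sum.distrib distrib_right)

lemma laurent_eval_sum: "laurent_eval (\<Sum>a\<in>A. f a) x = (\<Sum>a\<in>A. laurent_eval (f a) x)"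
  by (induction A rule: infinite_finite_induct) (auto simp: laurent_eval_add)

lemma laurent_poly_expand:
  "p = (\<Sum>m\<in>Poly_Mapping.keys p. Poly_Mapping.single m (Poly_Mapping.lookup p m))"
  for p :: "'a \<Rightarrow>\<^sub>0 'b::comm_monoid_add"
  by (intro poly_mapping_eqI)
    (auto simp: lookup_sum lookup_single when_def in_keys_iff sum.delta)

lemma laurent_eval_mult:
  assumes "x \<in> torus I" "p \<in> laurent_polys I" "q \<in> laurent_polys I"
  shows "laurent_eval (p * q) x = laurent_eval p x * laurent_eval q x"
proof -
  let ?s = "\<lambda>p m. Poly_Mapping.single m (Poly_Mapping.lookup p m)"
  have "p * q = (\<Sum>m\<in>Poly_Mapping.keys p. ?s p m) * (\<Sum>m\<in>Poly_Mapping.keys q. ?s q m)"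
    by (simp flip: laurent_poly_expand)
  also have "\<dots> = (\<Sum>m\<in>Poly_Mapping.keys p. \<Sum>m'\<in>Poly_Mapping.keys q.
      Poly_Mapping.single (m + m') (Poly_Mapping.lookup p m * Poly_Mapping.lookup q m'))"
    by (simp add: sum_product mult_single)
  also have "laurent_eval \<dots> x = (\<Sum>m\<in>Poly_Mapping.keys p. \<Sum>m'\<in>Poly_Mapping.keys q.
      (Poly_Mapping.lookup p m * laurent_monom m x) *
      (Poly_Mapping.lookup q m' * laurent_monom m' x))"
    unfolding laurent_eval_sum laurent_eval_single
    using assms by (intro sum.cong refl) (auto simp: laurent_polys_def laurent_monom_add)
  finally show ?thesis
    by (simp add: laurent_eval_def sum_product)
qed

lemma laurent_polys_mult:
  assumes "p \<in> laurent_polys I" "q \<in> laurent_polys I"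
  shows "p * q \<in> laurent_polys I"
proof -
  have "Poly_Mapping.keys (a + b) \<subseteq> I"
    if "a \<in> Poly_Mapping.keys p" "b \<in> Poly_Mapping.keys q" for a b
    using that assms Poly_Mapping.keys_add[of a b] unfolding laurent_polys_def by blast
  then show ?thesis
    using keys_mult[of p q] unfolding laurent_polys_def by blast
qed


section \<open>The Zariski topology, regular functions and birational maps\<close>

text \<open>Open sets are the complements of common zero loci of sets of Laurent polynomials.\<close>

definition zariski :: "'i set \<Rightarrow> ('i \<Rightarrow> complex) topology" where
  "zariski I = topology (\<lambda>U. \<exists>P \<subseteq> laurent_polys I.
     U = torus I - {x \<in> torus I. \<forall>p\<in>P. laurent_eval p x = 0})"

lemma openin_zariski:
  "openin (zariski I) U \<longleftrightarrow>
   (\<exists>P \<subseteq> laurent_polys I. U = torus I - {x \<in> torus I. \<forall>p\<in>P. laurent_eval p x = 0})"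
proof -
  let ?O = "\<lambda>U. \<exists>P \<subseteq> laurent_polys I.
     U = torus I - {x \<in> torus I. \<forall>p\<in>P. laurent_eval p x = 0}"
  have "istopology ?O"
    unfolding istopology_def
  proof (intro conjI allI impI)
    fix S T assume "?O S" "?O T"
    then obtain P Q where
      P: "P \<subseteq> laurent_polys I" "S = torus I - {x \<in> torus I. \<forall>p\<in>P. laurent_eval p x = 0}" and
      Q: "Q \<subseteq> laurent_polys I" "T = torus I - {x \<in> torus I. \<forall>p\<in>Q. laurent_eval p x = 0}"
      by blast
    let ?R = "(\<lambda>(p, q). p * q) ` (P \<times> Q)"
    have "?R \<subseteq> laurent_polys I"
      using P(1) Q(1) by (auto intro!: laurent_polys_mult)
    moreover have "laurent_eval (p * q) x = laurent_eval p x * laurent_eval q x"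
      if "x \<in> torus I" "p \<in> P" "q \<in> Q" for x p q
      using that P(1) Q(1) by (intro laurent_eval_mult) auto
    then have "S \<inter> T = torus I - {x \<in> torus I. \<forall>r\<in>?R. laurent_eval r x = 0}"
      unfolding P(2) Q(2) by auto
    ultimately show "?O (S \<inter> T)" by blast
  next
    fix \<K> assume "\<forall>K\<in>\<K>. ?O K"
    from bchoice[OF this] obtain P where P: "\<forall>K\<in>\<K>. P K \<subseteq> laurent_polys I \<and>
        K = torus I - {x \<in> torus I. \<forall>p\<in>P K. laurent_eval p x = 0}"
      ..
    have "x \<in> \<Union>\<K> \<longleftrightarrow> x \<in> torus I \<and> (\<exists>K\<in>\<K>. \<exists>p\<in>P K. laurent_eval p x \<noteq> 0)" for x
    proof -
      have "x \<in> K \<longleftrightarrow> x \<in> torus I \<and> (\<exists>p\<in>P K. laurent_eval p x \<noteq> 0)" if "K \<in> \<K>" for K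
        by (subst P[rule_format, OF that, THEN conjunct2]) auto
      then show ?thesis by auto
    qed
    then have "\<Union>\<K> = torus I - {x \<in> torus I. \<forall>p\<in>(\<Union>K\<in>\<K>. P K). laurent_eval p x = 0}"
      by auto
    moreover have "(\<Union>K\<in>\<K>. P K) \<subseteq> laurent_polys I"
      using P by blast
    ultimately show "?O (\<Union>\<K>)" by blast
  qed
  then show ?thesis
    unfolding zariski_def by (simp add: topology_inverse')
qed

lemma topspace_zariski [simp]: "topspace (zariski I) = torus I"
proof
  show "topspace (zariski I) \<subseteq> torus I"
    using openin_topspace[of "zariski I"] unfolding openin_zariski by blast
  have "1 \<in> laurent_polys I"
    by (simp add: laurent_polys_def)
  then have "openin (zariski I) (torus I)"
    unfolding openin_zariski by (intro exI[of _ "{1}"]) auto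
  then show "torus I \<subseteq> topspace (zariski I)"
    by (rule openin_subset)
qed

text \<open>
  In the following, \<open>U\<close>, \<open>V\<close>, \<open>X\<close>, \<open>Z\<close> are meant to be locally closed subsets of tori;
  the values of functions outside their domain are irrelevant.
\<close>

definition regular_function :: "'i set \<Rightarrow> ('i \<Rightarrow> complex) set \<Rightarrow> (('i \<Rightarrow> complex) \<Rightarrow> complex) \<Rightarrow> bool"
  where
  "regular_function I U f \<longleftrightarrow>
    (\<forall>x\<in>U. \<exists>W p q. openin (subtopology (zariski I) U) W \<and> x \<in> W \<and>
       p \<in> laurent_polys I \<and> q \<in> laurent_polys I \<and>
       (\<forall>y\<in>W. laurent_eval q y \<noteq> 0 \<and> f y = laurent_eval p y / laurent_eval q y))"

definition regular_map ::
  "'i set \<Rightarrow> ('i \<Rightarrow> complex) set \<Rightarrow> 'j set \<Rightarrow> ('j \<Rightarrow> complex) set \<Rightarrow>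
   (('i \<Rightarrow> complex) \<Rightarrow> ('j \<Rightarrow> complex)) \<Rightarrow> bool" where
  "regular_map I U J V \<phi> \<longleftrightarrow>
    \<phi> \<in> U \<rightarrow> V \<and> (\<forall>j\<in>J. regular_function I U (\<lambda>x. \<phi> x j))"

definition dense_open :: "'i set \<Rightarrow> ('i \<Rightarrow> complex) set \<Rightarrow> ('i \<Rightarrow> complex) set \<Rightarrow> bool" where
  "dense_open I X U \<longleftrightarrow>
    openin (subtopology (zariski I) X) U \<and> subtopology (zariski I) X closure_of U = X"

text \<open>
  The rational map from \<open>X\<close> to \<open>Z\<close> represented by \<open>\<phi>\<close> on the dense open subset \<open>U\<close>
  of \<open>X\<close> is a birational equivalence, \<open>U\<close> being small enough for \<open>\<phi>\<close> to map it
  isomorphically onto a dense open subset of \<open>Z\<close>.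
\<close>

definition birational_equivalence ::
  "'i set \<Rightarrow> ('i \<Rightarrow> complex) set \<Rightarrow> 'j set \<Rightarrow> ('j \<Rightarrow> complex) set \<Rightarrow>
   ('i \<Rightarrow> complex) set \<Rightarrow> (('i \<Rightarrow> complex) \<Rightarrow> ('j \<Rightarrow> complex)) \<Rightarrow> bool" where
  "birational_equivalence I X J Z U \<phi> \<longleftrightarrow>
    dense_open I X U \<and>
    (\<exists>V \<psi>. dense_open J Z V \<and> regular_map I U J V \<phi> \<and> regular_map J V I U \<psi> \<and>
       (\<forall>x\<in>U. \<psi> (\<phi> x) = x) \<and> (\<forall>z\<in>V. \<phi> (\<psi> z) = z))"


section \<open>The quiver and its blocks\<close>

datatype arrow = Vert nat nat | Horiz nat nat

definition quiver :: "nat \<Rightarrow> nat \<Rightarrow> (nat \<times> nat, arrow) pre_digraph" where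
  "quiver k n = \<lparr>
     verts = {1..k} \<times> {1..n} \<union> {(0, 1), (k, n + 1)},
     arcs = {Vert i j | i j. i \<in> {1..k-1} \<and> j \<in> {1..n}} \<union>
            {Horiz i j | i j. i \<in> {1..k} \<and> j \<in> {1..n-1}} \<union>
            {Vert 0 1, Horiz k n},
     tail = (\<lambda>\<alpha>. case \<alpha> of Vert i j \<Rightarrow> (i, j) | Horiz i j \<Rightarrow> (i, j)),
     head = (\<lambda>\<alpha>. case \<alpha> of Vert i j \<Rightarrow> (i + 1, j) | Horiz i j \<Rightarrow> (i, j + 1)) \<rparr>"

definition HB :: "nat \<Rightarrow> nat \<Rightarrow> nat \<Rightarrow> nat \<Rightarrow> arrow set" where
  "HB k n r s = {\<alpha> \<in> arcs (quiver k n). \<exists>i j. \<alpha> = Vert i j \<and> r \<le> i \<and> i < s}"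

definition VB :: "nat \<Rightarrow> nat \<Rightarrow> nat \<Rightarrow> nat \<Rightarrow> arrow set" where
  "VB k n r s = {\<alpha> \<in> arcs (quiver k n). \<exists>i j. \<alpha> = Horiz i j \<and> r \<le> j \<and> j < s}"

definition MB :: "nat \<Rightarrow> nat \<Rightarrow> nat \<Rightarrow> nat \<Rightarrow> arrow set" where
  "MB k n r s = HB k n r k \<union> VB k n 1 s"

definition is_block :: "nat \<Rightarrow> nat \<Rightarrow> arrow set \<Rightarrow> bool" where
  "is_block k n B \<longleftrightarrow>
    (\<exists>r s. r < s \<and> s \<le> k \<and> B = HB k n r s) \<or>
    (\<exists>r s. 1 \<le> r \<and> r < s \<and> s \<le> n + 1 \<and> B = VB k n r s) \<or>
    (\<exists>r s. r < k \<and> 1 < s \<and> s \<le> n + 1 \<and> B = MB k n r s)"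

definition consecutive_block :: "nat \<Rightarrow> nat \<Rightarrow> (nat \<Rightarrow> nat) \<Rightarrow> nat \<Rightarrow> arrow set" where
  "consecutive_block k n d p =
    (let u = (\<Sum>i=1..p-1. d i); u' = (\<Sum>i=1..p. d i) in
     if u' \<le> k then HB k n u u'
     else if u < k then MB k n u (u' - k + 1)
     else VB k n (u - k + 1) (u' - k + 1))"

lemma wf_digraph_quiver:
  assumes "k \<ge> 1" "n \<ge> 1"
  shows "wf_digraph (quiver k n)"
  using assms by unfold_locales (auto simp: quiver_def)

text \<open>
  The explicit description of consecutive blocks agrees with the abstract one: they are
  pairwise disjoint blocks, the first one contains the arrow starting at \<open>(0, 1)\<close>, and
  the union of each initial segment is a block.
\<close>

fun arrow_level :: "nat \<Rightarrow> arrow \<Rightarrow> nat" where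
  "arrow_level k (Vert i j) = i"
| "arrow_level k (Horiz i j) = k + j - 1"

lemma consecutive_block_eq_level:
  assumes "1 \<le> p" "k \<ge> 1" "n \<ge> 1"
  shows "consecutive_block k n d p =
    {\<alpha> \<in> arcs (quiver k n). (\<Sum>i=1..p-1. d i) \<le> arrow_level k \<alpha> \<and> arrow_level k \<alpha> < (\<Sum>i=1..p. d i)}"
proof -
  have v: "i < k" if "Vert i j \<in> arcs (quiver k n)" for i j
    using that assms by (auto simp: quiver_def)
  have h: "1 \<le> j" if "Horiz i j \<in> arcs (quiver k n)" for i j
    using that assms by (auto simp: quiver_def)
  show ?thesis
    unfolding consecutive_block_def Let_def MB_def HB_def VB_def
    apply (rule set_eqI)
    subgoal for \<alpha> by (cases \<alpha>) (auto dest: v h)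
    done
qed

lemma consecutive_blocks_disjoint:
  assumes "1 \<le> p" "p < q" "k \<ge> 1" "n \<ge> 1"
  shows "consecutive_block k n d p \<inter> consecutive_block k n d q = {}"
proof -
  have "(\<Sum>i=1..p. d i) \<le> (\<Sum>i=1..q-1. d i)"
    using assms by (intro sum_mono2) auto
  then show ?thesis
    using assms by (auto simp: consecutive_block_eq_level)
qed

lemma Vert_0_1_in_first_block:
  assumes "k \<ge> 1" "n \<ge> 1" "d 1 > 0"
  shows "Vert 0 1 \<in> consecutive_block k n d 1"
  using assms by (auto simp: consecutive_block_eq_level quiver_def)

lemma consecutive_blocks_Union:
  assumes "k \<ge> 1" "n \<ge> 1"
  shows "(\<Union>q\<in>{1..p}. consecutive_block k n d q) = 
    {\<alpha> \<in> arcs (quiver k n). arrow_level k \<alpha> < (\<Sum>i=1..p. d i)}"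
proof (induction p)
  case (Suc p)
  have "(\<Union>q\<in>{1..Suc p}. consecutive_block k n d q) =
      (\<Union>q\<in>{1..p}. consecutive_block k n d q) \<union> consecutive_block k n d (Suc p)"
    by (auto simp: atLeastAtMostSuc_conv)
  also have "\<dots> = {\<alpha> \<in> arcs (quiver k n). arrow_level k \<alpha> < (\<Sum>i=1..Suc p. d i)}"
    using assms unfolding Suc.IH by (auto simp: consecutive_block_eq_level)
  finally show ?case .
qed auto

lemma is_block_consecutive_block:
  assumes "k \<ge> 1" "n \<ge> 1" "1 \<le> p" "d p > 0" "(\<Sum>i=1..p. d i) \<le> n + k"
  shows "is_block k n (consecutive_block k n d p)"
proof -
  obtain p' where p': "p = Suc p'" using assms by (cases p) auto
  define u where "u = (\<Sum>i=1..p-1. d i)"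
  define u' where "u' = (\<Sum>i=1..p. d i)"
  have "u < u'" using assms unfolding u_def u'_def p' by simp
  moreover have "u' \<le> n + k" using assms by (simp add: u'_def)
  moreover have "is_block k n (HB k n u u')" if "u' \<le> k"
    using that \<open>u < u'\<close> unfolding is_block_def by blast
  moreover have "is_block k n (MB k n u (u' - k + 1))" if "\<not> u' \<le> k" "u < k"
  proof -
    have "1 < u' - k + 1" "u' - k + 1 \<le> n + 1" using that \<open>u' \<le> n + k\<close> by auto
    then show ?thesis using that unfolding is_block_def by blast
  qed
  moreover have "is_block k n (VB k n (u - k + 1) (u' - k + 1))" if "\<not> u' \<le> k" "\<not> u < k"
  proof -
    have "1 \<le> u - k + 1" "u - k + 1 < u' - k + 1" "u' - k + 1 \<le> n + 1"
      using that \<open>u < u'\<close> \<open>u' \<le> n + k\<close> by auto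
    then show ?thesis unfolding is_block_def by blast
  qed
  ultimately show ?thesis
    unfolding consecutive_block_def Let_def u_def[symmetric] u'_def[symmetric] by simp
qed

lemma is_block_consecutive_blocks_Union:
  assumes "k \<ge> 1" "n \<ge> 1" "1 \<le> p" "d 1 > 0" "(\<Sum>i=1..p. d i) \<le> n + k"
  shows "is_block k n (\<Union>q\<in>{1..p}. consecutive_block k n d q)"
proof -
  let ?d = "\<lambda>_. (\<Sum>i=1..p. d i)"
  have "d 1 \<le> (\<Sum>i=1..p. d i)"
    using assms by (intro member_le_sum) auto
  then have "is_block k n (consecutive_block k n ?d 1)"
    using assms by (intro is_block_consecutive_block) auto
  also have "consecutive_block k n ?d 1 = (\<Union>q\<in>{1..p}. consecutive_block k n d q)"
    using assms unfolding consecutive_blocks_Union[OF assms(1,2)]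
    by (auto simp: consecutive_block_eq_level)
  finally show ?thesis .
qed


section \<open>The functions attached to sets of arrows and the subvariety\<close>

definition variables :: "nat \<Rightarrow> nat \<Rightarrow> (nat \<times> nat) set" where
  "variables k n = {1..k} \<times> {1..n}"

definition vertex_value :: "nat \<Rightarrow> nat \<Rightarrow> (nat \<times> nat \<Rightarrow> complex) \<Rightarrow> nat \<times> nat \<Rightarrow> complex" where
  "vertex_value k n a v = (if v = (0, 1) \<or> v = (k, n + 1) then 1 else a v)"

definition F_tilde :: "nat \<Rightarrow> nat \<Rightarrow> arrow set \<Rightarrow> (nat \<times> nat \<Rightarrow> complex) \<Rightarrow> complex" where
  "F_tilde k n A a = (\<Sum>\<alpha>\<in>A.
     vertex_value k n a (head (quiver k n) \<alpha>) / vertex_value k n a (tail (quiver k n) \<alpha>))"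

definition L_tilde :: "nat \<Rightarrow> nat \<Rightarrow> nat \<Rightarrow> (nat \<Rightarrow> nat) \<Rightarrow> (nat \<times> nat \<Rightarrow> complex) set" where
  "L_tilde k n l d =
    {a \<in> torus (variables k n). \<forall>p\<in>{1..l}. F_tilde k n (consecutive_block k n d p) a = 1}"

definition B\<^sub>0 :: "nat \<Rightarrow> nat \<Rightarrow> nat \<Rightarrow> (nat \<Rightarrow> nat) \<Rightarrow> arrow set" where
  "B\<^sub>0 k n l d = arcs (quiver k n) - (\<Union>p\<in>{1..l}. consecutive_block k n d p)"

end

theory Submission
  imports Defs "HOL-Complex_Analysis.Conformal_Mappings"
begin

text \<open>
  Give every arrow a level, \<open>i\<close> for \<open>Vert i j\<close> and \<open>k + j - 1\<close> for \<open>Horiz i j\<close>. The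
  consecutive blocks are the sets of arrows whose levels lie in consecutive intervals, and
  all levels from \<open>(\<Sum>i=1..l. d i)\<close> to \<open>k + n - 1\<close> make up \<open>B\<^sub>0\<close>. The only arrow of level
  \<open>k + n - 1\<close> is \<open>Horiz k n\<close>, and the bound on the degrees puts it into \<open>B\<^sub>0\<close>.

  All paths from \<open>(0, 1)\<close> to a vertex \<open>v\<close> pass the same levels. Given nonzero numbers
  \<open>s m\<close>, one for each level, multiply the variable at \<open>v\<close> by the product of \<open>s m\<close> over the
  levels passed on the way to \<open>v\<close>. The summand of an arrow is then multiplied by the number
  of its own level, with the exception of \<open>Horiz k n\<close>: its head has the fixed value \<open>1\<close>, and
  its summand is divided by the numbers of all lower levels. With the same number
  \<open>t p\<close> on all levels of the \<open>p\<close>-th block and \<open>1\<close> on the levels of \<open>B\<^sub>0\<close>, this is an action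
  of an \<open>l\<close>-dimensional torus, under which the function of the \<open>p\<close>-th block is
  multiplied by \<open>t p\<close>. So an orbit on which all the block functions are nonzero contains
  exactly one point of the subvariety, obtained by taking for \<open>t p\<close> the inverse of the
  block function.

  The orbits form a torus of dimension \<open>n * k - l\<close>. To see this, follow the path down the
  first column and along the last row, which passes each level once, and require that
  the variables at both ends of its first step in each block agree. These \<open>l\<close> conditions
  fix \<open>t\<close> on each orbit, since the action multiplies the ratio along such a step by \<open>t p\<close>. They
  only identify variables with each other or with \<open>1\<close>, so the slice that they define is a
  torus with the remaining variables as coordinates. The map \<open>normalize_blocks\<close> from the
  slice to the subvariety is birational: it is inverse to the map that moves a point of
  the subvariety along its orbit back to the slice, and it is defined where a nonzero
  Laurent polynomial does not vanish, which is a dense open set since a torus is irreducible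
  (\<open>laurent_nonvanishing_meet\<close>).

  Finally, pull back the function of \<open>B\<^sub>0\<close>. Its arrows other than \<open>Horiz k n\<close> are invariant,
  and the summand of \<open>Horiz k n\<close> is divided by inverse block functions, that is,
  multiplied by block functions (\<open>F_complement_normalize_blocks\<close>). Restricted to the slice,
  the result is a Laurent polynomial.
\<close>


section \<open>Laurent functions\<close>

definition laurent_function :: "'i set \<Rightarrow> (('i \<Rightarrow> complex) \<Rightarrow> complex) \<Rightarrow> bool" where
  "laurent_function I f \<longleftrightarrow> (\<exists>p\<in>laurent_polys I. \<forall>x\<in>torus I. f x = laurent_eval p x)"

lemma torus_nonzero: "x \<in> torus I \<Longrightarrow> i \<in> I \<Longrightarrow> x i \<noteq> 0"
  by (auto simp: torus_def PiE_iff)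

lemma laurent_function_const [intro, simp]: "laurent_function I (\<lambda>_. c)"
  unfolding laurent_function_def
  by (rule bexI[of _ "Poly_Mapping.single 0 c"])
    (auto simp: laurent_polys_def laurent_monom_def)

lemma laurent_function_add:
  assumes "laurent_function I f" "laurent_function I g"
  shows "laurent_function I (\<lambda>x. f x + g x)"
proof -
  obtain p q where pq: "p \<in> laurent_polys I" "q \<in> laurent_polys I"
    and f: "\<forall>x\<in>torus I. f x = laurent_eval p x" and g: "\<forall>x\<in>torus I. g x = laurent_eval q x"
    using assms unfolding laurent_function_def by blast
  have "p + q \<in> laurent_polys I"
    using pq Poly_Mapping.keys_add[of p q] unfolding laurent_polys_def by blast
  then show ?thesis
    unfolding laurent_function_def using f g
    by (intro bexI[of _ "p + q"]) (auto simp: laurent_eval_add)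
qed

lemma laurent_function_mult:
  assumes "laurent_function I f" "laurent_function I g"
  shows "laurent_function I (\<lambda>x. f x * g x)"
proof -
  obtain p q where pq: "p \<in> laurent_polys I" "q \<in> laurent_polys I"
    and f: "\<forall>x\<in>torus I. f x = laurent_eval p x" and g: "\<forall>x\<in>torus I. g x = laurent_eval q x"
    using assms unfolding laurent_function_def by blast
  then show ?thesis
    unfolding laurent_function_def using f g
    by (intro bexI[of _ "p * q"] laurent_polys_mult) (auto simp: laurent_eval_mult)
qed

lemma laurent_function_sum:
  "(\<And>a. a \<in> A \<Longrightarrow> laurent_function I (f a)) \<Longrightarrow> laurent_function I (\<lambda>x. \<Sum>a\<in>A. f a x)"
  by (induction A rule: infinite_finite_induct) (auto intro: laurent_function_add)

lemma laurent_function_prod: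
  "(\<And>a. a \<in> A \<Longrightarrow> laurent_function I (f a)) \<Longrightarrow> laurent_function I (\<lambda>x. \<Prod>a\<in>A. f a x)"
  by (induction A rule: infinite_finite_induct) (auto intro: laurent_function_mult)

lemma laurent_function_powi:
  assumes "i \<in> I"
  shows "laurent_function I (\<lambda>x. x i powi e)"
  unfolding laurent_function_def
  by (rule bexI[of _ "Poly_Mapping.single (Poly_Mapping.single i e) 1"])
    (use assms in \<open>auto simp: laurent_polys_def laurent_monom_def\<close>)

lemma laurent_function_coordinate: "i \<in> I \<Longrightarrow> laurent_function I (\<lambda>x. x i)"
  using laurent_function_powi[of i I 1] by simp

lemma laurent_function_inverse_coordinate:
  "i \<in> I \<Longrightarrow> laurent_function I (\<lambda>x. inverse (x i))"
  using laurent_function_powi[of i I "-1"] by (simp add: power_int_minus)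

lemma regular_function_quotient:
  assumes U: "U \<subseteq> torus I" and f: "laurent_function I f" and g: "laurent_function I g"
    and nz: "\<And>x. x \<in> U \<Longrightarrow> g x \<noteq> 0" and h: "\<And>x. x \<in> U \<Longrightarrow> h x = f x / g x"
  shows "regular_function I U h"
proof -
  obtain p q where pq: "p \<in> laurent_polys I" "q \<in> laurent_polys I"
    "\<forall>x\<in>torus I. f x = laurent_eval p x" "\<forall>x\<in>torus I. g x = laurent_eval q x"
    using f g unfolding laurent_function_def by blast
  have "openin (subtopology (zariski I) U) U"
    using openin_topspace[of "subtopology (zariski I) U"] U by (simp add: Int_absorb1)
  moreover have "\<forall>y\<in>U. laurent_eval q y \<noteq> 0 \<and> h y = laurent_eval p y / laurent_eval q y"
    using pq nz h U by (metis subsetD)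
  ultimately show ?thesis
    unfolding regular_function_def using pq(1,2) by blast
qed

lemma regular_function_laurent:
  assumes "U \<subseteq> torus I" "laurent_function I f"
  shows "regular_function I U f"
  using assms by (intro regular_function_quotient[of U I f "\<lambda>_. 1"]) auto

text \<open>
  A torus is irreducible: any two of its points lie on an entire curve, the image of a
  complex line under the exponential map. Laurent polynomials become entire functions along
  this curve, and the entire functions have no zero divisors by analytic continuation.
\<close>

lemma laurent_nonvanishing_meet:
  assumes p: "p \<in> laurent_polys I" and q: "q \<in> laurent_polys I"
    and x: "x \<in> torus I" and y: "y \<in> torus I"
    and px: "laurent_eval p x \<noteq> 0" and qy: "laurent_eval q y \<noteq> 0"
  shows "\<exists>z\<in>torus I. laurent_eval p z \<noteq> 0 \<and> laurent_eval q z \<noteq> 0"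
proof (rule ccontr)
  \<comment> \<open>The curve through \<open>x\<close> at \<open>s = 0\<close> and through \<open>y\<close> at \<open>s = 1\<close>.\<close>
  define \<gamma> where "\<gamma> = (\<lambda>(s::complex). restrict (\<lambda>i. exp (Ln (x i) + s * (Ln (y i) - Ln (x i)))) I)"
  assume "\<not> ?thesis"
  moreover have "\<gamma> s \<in> torus I" for s
    by (auto simp: \<gamma>_def torus_def)
  ultimately have zero: "laurent_eval p (\<gamma> s) = 0 \<or> laurent_eval q (\<gamma> s) = 0" for s
    by blast
  have \<gamma>0: "\<gamma> 0 = x"
    using x torus_nonzero[OF x] by (intro ext) (auto simp: \<gamma>_def torus_def PiE_iff extensional_def)
  have \<gamma>1: "\<gamma> 1 = y"
    using y torus_nonzero[OF y] by (intro ext) (auto simp: \<gamma>_def torus_def PiE_iff extensional_def)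
  have hol: "(\<lambda>s. laurent_eval r (\<gamma> s)) holomorphic_on UNIV" if r: "r \<in> laurent_polys I" for r
  proof -
    have "(\<lambda>s. laurent_monom m (\<gamma> s)) holomorphic_on UNIV" if "m \<in> Poly_Mapping.keys r" for m
    proof -
      have "Poly_Mapping.keys m \<subseteq> I"
        using r that by (auto simp: laurent_polys_def)
      then have "laurent_monom m (\<gamma> s) = (\<Prod>i\<in>Poly_Mapping.keys m.
          exp (Ln (x i) + s * (Ln (y i) - Ln (x i))) powi Poly_Mapping.lookup m i)" for s
        unfolding laurent_monom_def \<gamma>_def by (intro prod.cong) auto
      then show ?thesis
        by (auto intro!: holomorphic_intros)
    qed
    then show ?thesis
      unfolding laurent_eval_def by (intro holomorphic_intros)
  qed
  have "continuous_on UNIV (\<lambda>s. laurent_eval p (\<gamma> s))"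
    using hol[OF p] by (rule holomorphic_on_imp_continuous_on)
  then have op: "open {s. laurent_eval p (\<gamma> s) \<noteq> 0}"
    by (intro open_Collect_neq continuous_intros) auto
  have "laurent_eval q (\<gamma> 1) = 0"
    by (rule analytic_continuation_open[OF op, of UNIV "\<lambda>s. laurent_eval q (\<gamma> s)" "\<lambda>_. 0"])
      (use zero px \<gamma>0 hol[OF q] in \<open>auto intro!: exI[of _ 0]\<close>)
  with qy \<gamma>1 show False by simp
qed

lemma dense_open_nonvanishing:
  assumes f: "laurent_function I f" and x: "x \<in> torus I" "f x \<noteq> 0"
  shows "dense_open I (torus I) {y \<in> torus I. f y \<noteq> 0}"
proof -
  obtain p where p: "p \<in> laurent_polys I" "\<forall>y\<in>torus I. f y = laurent_eval p y"
    using f unfolding laurent_function_def by blast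
  define U where "U = {y \<in> torus I. f y \<noteq> 0}"
  have top: "subtopology (zariski I) (torus I) = zariski I"
    using subtopology_topspace[of "zariski I"] by simp
  have "openin (zariski I) U"
    unfolding openin_zariski U_def using p by (intro exI[of _ "{p}"]) auto
  moreover have "y \<in> zariski I closure_of U" if y: "y \<in> torus I" for y
    unfolding in_closure_of
  proof (intro conjI allI impI)
    show "y \<in> topspace (zariski I)" using y by simp
  next
    fix T assume T: "y \<in> T \<and> openin (zariski I) T"
    then obtain Q where Q: "Q \<subseteq> laurent_polys I"
      "T = torus I - {x \<in> torus I. \<forall>q\<in>Q. laurent_eval q x = 0}"
      unfolding openin_zariski by blast
    with T obtain q where q: "q \<in> Q" "laurent_eval q y \<noteq> 0" by blast
    obtain z where z: "z \<in> torus I" "laurent_eval p z \<noteq> 0" "laurent_eval q z \<noteq> 0"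
      using laurent_nonvanishing_meet[of p I q x y] p x q Q y by auto
    then have "z \<in> U" "z \<in> T" using p q Q by (auto simp: U_def)
    then show "\<exists>z. z \<in> U \<and> z \<in> T" by blast
  qed
  ultimately show ?thesis
    unfolding dense_open_def top U_def[symmetric]
    using closure_of_subset_topspace[of "zariski I" U] by auto
qed

lemma dense_open_self: "X \<subseteq> torus I \<Longrightarrow> dense_open I X X"
  unfolding dense_open_def
  using openin_topspace[of "subtopology (zariski I) X"]
    closure_of_topspace[of "subtopology (zariski I) X"]
  by (simp add: Int_absorb1)


section \<open>Levels of arrows and rescaling of the variables\<close>

text \<open>
  The levels of the arrows on any path from \<open>(0, 1)\<close> to the vertex \<open>v\<close> of the grid; a path
  meets each of them once.
\<close>

definition passed_levels :: "nat \<Rightarrow> nat \<times> nat \<Rightarrow> nat set" where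
  "passed_levels k v = {..<fst v} \<union> {k..<k + snd v - 1}"

text \<open>The vertices of the path that descends the first column and then follows the last row.\<close>

definition boundary_path :: "nat \<Rightarrow> nat \<Rightarrow> nat \<times> nat" where
  "boundary_path k m = (if m \<le> k then (m, 1) else (k, m - k + 1))"

text \<open>
  Number the vertices of a path from \<open>0\<close> and its steps by their starting vertices. When the
  steps in \<open>S\<close> are contracted, each vertex becomes identified with the last vertex, at or
  before it, that does not end a contracted step.
\<close>

primrec contract_steps :: "nat set \<Rightarrow> nat \<Rightarrow> nat" where
  "contract_steps S 0 = 0"
| "contract_steps S (Suc m) = (if m \<in> S then contract_steps S m else Suc m)"

lemma contract_steps_le: "contract_steps S m \<le> m"
  by (induction m) auto

lemma contract_steps_cases:
  "contract_steps S m = 0 \<or> (\<exists>m'. contract_steps S m = Suc m' \<and> m' \<notin> S)"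
  by (induction m) auto

lemma boundary_path_position: "boundary_path k m = v \<Longrightarrow> m = fst v + snd v - 1"
  by (auto simp: boundary_path_def)

lemma boundary_path_inject: "boundary_path k m = boundary_path k m' \<longleftrightarrow> m = m'"
  by (metis boundary_path_position)

lemma passed_levels_boundary_path: "passed_levels k (boundary_path k m) = {..<m}"
  by (auto simp: passed_levels_def boundary_path_def)

locale consecutive_blocks =
  fixes k n l :: nat and d :: "nat \<Rightarrow> nat"
  assumes k: "k \<ge> 2" and n: "n \<ge> 2"
    and d_pos: "\<And>i. i \<in> {1..l} \<Longrightarrow> d i > 0"
    and d_sum: "(\<Sum>i=1..l. d i) < n + k"
begin

abbreviation "V \<equiv> variables k n"
abbreviation "val \<equiv> vertex_value k n"
abbreviation "Q \<equiv> quiver k n"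
abbreviation "bpath \<equiv> boundary_path k"
abbreviation "passed \<equiv> passed_levels k"

definition rescale :: "(nat \<Rightarrow> complex) \<Rightarrow> (nat \<times> nat \<Rightarrow> complex) \<Rightarrow> nat \<times> nat \<Rightarrow> complex" where
  "rescale s b = restrict (\<lambda>v. b v * (\<Prod>m\<in>passed v. s m)) V"

lemma path_in_variables: "0 < m \<Longrightarrow> m < k + n \<Longrightarrow> bpath m \<in> V"
  using k n by (auto simp: boundary_path_def variables_def)

lemma path_0: "bpath 0 = (0, 1)"
  by (simp add: boundary_path_def)

lemma path_in_vertices: "m < k + n \<Longrightarrow> bpath m \<in> insert (0, 1) V"
  using path_in_variables[of m] path_0 by (cases "m = 0") auto

lemma val_variables [simp]: "v \<in> V \<Longrightarrow> val a v = a v"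
  using k n by (auto simp: vertex_value_def variables_def)

lemma val_source [simp]: "val a (0, Suc 0) = 1"
  by (simp add: vertex_value_def)

lemma val_sink [simp]: "val a (k, Suc n) = 1"
  by (simp add: vertex_value_def)

lemma val_nonzero: "a \<in> torus V \<Longrightarrow> v \<in> insert (0, 1) V \<Longrightarrow> val a v \<noteq> 0"
  using torus_nonzero[of a V v] by auto

lemma finite_passed [simp]: "finite (passed v)"
  by (simp add: passed_levels_def)

lemma rescale_in_torus:
  assumes "b \<in> torus V" "\<And>m. s m \<noteq> 0"
  shows "rescale s b \<in> torus V"
  using assms torus_nonzero[OF assms(1)] by (auto simp: rescale_def torus_def)

lemma rescale_rescale_inverse:
  assumes "b \<in> torus V" "\<And>m. s m \<noteq> 0" "\<And>m. s' m = inverse (s m)"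
  shows "rescale s' (rescale s b) = b"
proof
  fix v
  have "(\<Prod>m\<in>passed v. s m) * (\<Prod>m\<in>passed v. s' m) = 1"
    using assms(2,3) by (simp flip: prod.distrib)
  moreover have "b v = undefined" if "v \<notin> V"
    using assms(1) that unfolding torus_def by (rule PiE_arb)
  ultimately show "rescale s' (rescale s b) v = b v"
    by (simp add: rescale_def mult.assoc)
qed

lemma val_rescale:
  assumes "v \<in> insert (0, 1) V"
  shows "val (rescale s b) v = val b v * (\<Prod>m\<in>passed v. s m)"
  using assms by (auto simp: rescale_def passed_levels_def)

text \<open>
  An arrow passes exactly its own level, except that \<open>Horiz k n\<close> returns to a vertex
  with the fixed value \<open>1\<close>.
\<close>

lemma arrow_passes_level:
  assumes "\<alpha> \<in> arcs Q" "\<alpha> \<noteq> Horiz k n"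
  shows "head Q \<alpha> \<in> V" "tail Q \<alpha> \<in> insert (0, 1) V"
    "passed (head Q \<alpha>) = insert (arrow_level k \<alpha>) (passed (tail Q \<alpha>))"
    "arrow_level k \<alpha> \<notin> passed (tail Q \<alpha>)"
  using assms k n by (auto simp: quiver_def variables_def passed_levels_def)

lemma finite_arcs: "finite (arcs Q)"
proof -
  have "arcs Q \<subseteq> (\<lambda>(i, j). Vert i j) ` ({..k} \<times> {..n}) \<union> (\<lambda>(i, j). Horiz i j) ` ({..k} \<times> {..n})"
    using k n by (auto simp: quiver_def)
  then show ?thesis
    by (rule finite_subset) auto
qed

text \<open>
  Telescoping: the scaling factors at both ends of an arrow differ by the factor of its level.
\<close>

lemma F_tilde_rescale:
  assumes A: "A \<subseteq> arcs Q" "Horiz k n \<notin> A"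
    and s: "\<And>\<alpha>. \<alpha> \<in> A \<Longrightarrow> s (arrow_level k \<alpha>) = c" "\<And>m. s m \<noteq> 0"
  shows "F_tilde k n A (rescale s b) = c * F_tilde k n A b"
  unfolding F_tilde_def sum_distrib_left
proof (rule sum.cong[OF refl])
  fix \<alpha> assume "\<alpha> \<in> A"
  then have \<alpha>: "\<alpha> \<in> arcs Q" "\<alpha> \<noteq> Horiz k n" using A by auto
  have "val (rescale s b) (head Q \<alpha>) = val b (head Q \<alpha>) * (\<Prod>m\<in>passed (head Q \<alpha>). s m)"
    using arrow_passes_level(1)[OF \<alpha>] by (intro val_rescale) auto
  also have "\<dots> = val b (head Q \<alpha>) * (c * (\<Prod>m\<in>passed (tail Q \<alpha>). s m))"
    using arrow_passes_level(3,4)[OF \<alpha>] s(1)[OF \<open>\<alpha> \<in> A\<close>] by simp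
  finally show "val (rescale s b) (head Q \<alpha>) / val (rescale s b) (tail Q \<alpha>) =
      c * (val b (head Q \<alpha>) / val b (tail Q \<alpha>))"
    using s(2) val_rescale[OF arrow_passes_level(2)[OF \<alpha>], of s b] by (simp add: prod_zero_iff)
qed


section \<open>The blocks as sets of levels\<close>

definition partial_sum :: "nat \<Rightarrow> nat" where
  "partial_sum p = (\<Sum>i=1..p. d i)"

text \<open>Levels beyond the last block, those of \<open>B\<^sub>0\<close>, get the index \<open>l + 1\<close>.\<close>

definition block_index :: "nat \<Rightarrow> nat" where
  "block_index m = (LEAST p. l < p \<or> m < partial_sum p)"

abbreviation "B \<equiv> consecutive_block k n d"

lemma partial_sum_0 [simp]: "partial_sum 0 = 0"
  by (simp add: partial_sum_def)

lemma partial_sum_mono: "p \<le> q \<Longrightarrow> partial_sum p \<le> partial_sum q"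
  unfolding partial_sum_def by (intro sum_mono2) auto

lemma partial_sum_less:
  assumes "p < q" "q \<le> l"
  shows "partial_sum p < partial_sum q"
proof -
  have "partial_sum p < partial_sum (Suc p)"
    using d_pos[of "Suc p"] assms by (simp add: partial_sum_def)
  also have "\<dots> \<le> partial_sum q"
    using assms by (intro partial_sum_mono) auto
  finally show ?thesis .
qed

lemma partial_sum_bound: "p \<le> l \<Longrightarrow> partial_sum p < k + n"
  using partial_sum_mono[of p l] d_sum by (simp add: partial_sum_def)

lemma block_index_eq:
  assumes "p \<in> {1..l}"
  shows "block_index m = p \<longleftrightarrow> partial_sum (p - 1) \<le> m \<and> m < partial_sum p"
proof
  assume p: "block_index m = p"
  have "l < block_index m \<or> m < partial_sum (block_index m)"
    unfolding block_index_def by (rule LeastI[of _ "Suc l"]) simp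
  moreover have "\<not> m < partial_sum (p - 1)"
    using not_less_Least[of "p - 1" "\<lambda>p. l < p \<or> m < partial_sum p"] p assms
    unfolding block_index_def by auto
  ultimately show "partial_sum (p - 1) \<le> m \<and> m < partial_sum p"
    using p assms by auto
next
  assume m: "partial_sum (p - 1) \<le> m \<and> m < partial_sum p"
  show "block_index m = p"
    unfolding block_index_def
  proof (rule Least_equality)
    show "l < p \<or> m < partial_sum p" using m by simp
    fix q assume q: "l < q \<or> m < partial_sum q"
    show "p \<le> q"
    proof (rule ccontr)
      assume "\<not> p \<le> q"
      then have "partial_sum q \<le> partial_sum (p - 1)"
        by (intro partial_sum_mono) auto
      with q m assms \<open>\<not> p \<le> q\<close> show False by auto
    qed
  qed
qed

lemma block_index_ge_1: "block_index m \<ge> 1"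
proof -
  have "l < block_index m \<or> m < partial_sum (block_index m)"
    unfolding block_index_def by (rule LeastI[of _ "Suc l"]) simp
  then show ?thesis by (cases "block_index m = 0") auto
qed

lemma block_eq: "p \<in> {1..l} \<Longrightarrow> B p = {\<alpha> \<in> arcs Q. block_index (arrow_level k \<alpha>) = p}"
  using k n block_index_eq[of p]
  by (simp add: consecutive_block_eq_level partial_sum_def)

lemma block_index_last_level: "l < block_index (k + n - 1)"
proof (rule ccontr)
  assume "\<not> ?thesis"
  then have "block_index (k + n - 1) \<in> {1..l}" using block_index_ge_1 by auto
  from block_index_eq[OF this, of "k + n - 1"] this partial_sum_bound show False
    by fastforce
qed

lemma Horiz_k_n_notin_block: "p \<in> {1..l} \<Longrightarrow> Horiz k n \<notin> B p"
  using block_index_last_level by (auto simp: block_eq)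

lemma complement_block_eq: "B\<^sub>0 k n l d = {\<alpha> \<in> arcs Q. l < block_index (arrow_level k \<alpha>)}"
  using block_index_ge_1 by (auto simp: B\<^sub>0_def block_eq not_less Suc_le_eq)

lemma block_nonempty:
  assumes p: "p \<in> {1..l}"
  shows "B p \<noteq> {}"
proof -
  define m where "m = partial_sum (p - 1)"
  define \<alpha> where "\<alpha> = (if m < k then Vert m 1 else Horiz 1 (m - k + 1))"
  have "block_index m = p"
    using p partial_sum_less[of "p - 1" p] unfolding block_index_eq[OF p] m_def by auto
  moreover have "arrow_level k \<alpha> = m"
    by (simp add: \<alpha>_def)
  moreover have "m < partial_sum l"
    using p partial_sum_less[of "p - 1" l] unfolding m_def by auto
  then have "m < k + n - 1"
    using partial_sum_bound[of l] by simp
  then have "\<alpha> \<in> arcs Q"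
    using k n by (auto simp: \<alpha>_def quiver_def)
  ultimately show ?thesis
    using p by (auto simp: block_eq)
qed


section \<open>A slice of the rescaling action\<close>

text \<open>The lowest level of each block.\<close>

definition first_levels :: "nat set" where
  "first_levels = partial_sum ` {..<l}"

definition contract_vertex :: "nat \<times> nat \<Rightarrow> nat \<times> nat" where
  "contract_vertex v = (let m = fst v + snd v - 1 in
     if v = bpath m then bpath (contract_steps first_levels m) else v)"

text \<open>
  The first step of each block along the boundary path is contracted, so the variable at its
  end is no longer free.
\<close>

definition free_vertices :: "(nat \<times> nat) set" where
  "free_vertices = V - (\<lambda>m. bpath (Suc m)) ` first_levels"

definition numbering :: "nat \<times> nat \<Rightarrow> nat" where
  "numbering = (SOME f. bij_betw f free_vertices {1..n*k-l})"

abbreviation "Y \<equiv> {1..n*k-l}"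

text \<open>
  The point of the slice with the given values at the free vertices. A vertex that is
  contracted to \<open>(0, 1)\<close> inherits the fixed value \<open>1\<close> of that vertex.
\<close>

definition slice_point :: "(nat \<Rightarrow> complex) \<Rightarrow> nat \<times> nat \<Rightarrow> complex" where
  "slice_point y = restrict (\<lambda>v. let w = contract_vertex v in
     if w = (0, 1) then 1 else y (numbering w)) V"

lemma first_levels_bound: "m \<in> first_levels \<Longrightarrow> Suc m < k + n"
  using partial_sum_less partial_sum_bound[of l] by (fastforce simp: first_levels_def)

lemma block_index_first_level:
  assumes p: "p \<in> {1..l}"
  shows "partial_sum (p - 1) \<in> first_levels" "block_index (partial_sum (p - 1)) = p"
  using p partial_sum_less[of "p - 1" p] by (auto simp: first_levels_def block_index_eq[OF p])

text \<open>
  The slice has the right dimension, because the lowest levels of the \<open>l\<close> blocks are distinct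
  and below \<open>k + n - 1\<close>, so that exactly \<open>l\<close> variables are removed.
\<close>

lemma numbering_bij: "bij_betw numbering free_vertices Y"
proof -
  have "inj_on (\<lambda>p. bpath (Suc (partial_sum p))) {..<l}"
    by (rule linorder_inj_onI) (use partial_sum_less in \<open>fastforce simp: boundary_path_inject\<close>)+
  then have "card ((\<lambda>m. bpath (Suc m)) ` first_levels) = l"
    unfolding first_levels_def image_image by (subst card_image) auto
  moreover have "(\<lambda>m. bpath (Suc m)) ` first_levels \<subseteq> V"
    using path_in_variables first_levels_bound by blast
  moreover have "card V = n * k"
    by (simp add: variables_def card_cartesian_product)
  ultimately have "card free_vertices = n * k - l"
    unfolding free_vertices_def by (subst card_Diff_subset) (auto simp: first_levels_def)
  then have "\<exists>f. bij_betw f free_vertices Y"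
    by (intro finite_same_card_bij) (auto simp: free_vertices_def variables_def)
  then show ?thesis
    unfolding numbering_def by (rule someI_ex)
qed

lemma contract_vertex_path: "contract_vertex (bpath m) = bpath (contract_steps first_levels m)"
  using boundary_path_position[of k m "bpath m"] by (simp add: contract_vertex_def Let_def)

lemma contract_vertex_first_level:
  "m \<in> first_levels \<Longrightarrow> contract_vertex (bpath (Suc m)) = contract_vertex (bpath m)"
  by (simp add: contract_vertex_path)

lemma contract_vertex_cases:
  assumes "v \<in> insert (0, 1) V"
  shows "contract_vertex v = (0, 1) \<or> contract_vertex v \<in> free_vertices"
proof (cases "\<exists>m. v = bpath m")
  case True
  then obtain m where m: "v = bpath m" by blast
  have "m < k + n"
    using assms k boundary_path_position[of k m v] m by (auto simp: variables_def)
  then have "contract_steps first_levels m < k + n"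
    using contract_steps_le[of first_levels m] by linarith
  with contract_steps_cases[of first_levels m] show ?thesis
    unfolding m contract_vertex_path
    by (auto simp: free_vertices_def boundary_path_inject path_0 intro!: path_in_variables)
next
  case False
  moreover from this have "v \<noteq> (0, 1)" using path_0 by metis
  ultimately show ?thesis
    using assms by (auto simp: contract_vertex_def Let_def free_vertices_def)
qed

lemma contract_vertex_free:
  assumes "v \<in> free_vertices"
  shows "contract_vertex v = v"
proof (cases "\<exists>m. v = bpath m")
  case True
  then obtain m where m: "v = bpath m" by blast
  have "v \<in> V" using assms by (simp add: free_vertices_def)
  moreover have "bpath 0 \<notin> V" by (simp add: path_0 variables_def)
  ultimately have "m \<noteq> 0" using m by metis
  then obtain m' where "m = Suc m'" by (cases m) auto
  with m assms show ?thesis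
    unfolding m contract_vertex_path by (auto simp: free_vertices_def)
next
  case False
  then show ?thesis by (auto simp: contract_vertex_def Let_def)
qed

lemma numbering_in: "v \<in> free_vertices \<Longrightarrow> numbering v \<in> Y"
  using numbering_bij by (rule bij_betwE[rule_format])

lemma slice_point_free: "v \<in> free_vertices \<Longrightarrow> slice_point y v = y (numbering v)"
  by (auto simp: slice_point_def contract_vertex_free Let_def free_vertices_def variables_def)

lemma slice_point_in_torus:
  assumes "y \<in> torus Y"
  shows "slice_point y \<in> torus V"
proof -
  have "slice_point y v \<noteq> 0" if "v \<in> V" for v
    using contract_vertex_cases[OF insertI2[OF that]] that
      torus_nonzero[OF assms numbering_in[of "contract_vertex v"]]
    by (auto simp: slice_point_def Let_def)
  then show ?thesis
    unfolding torus_def by (intro PiE_I) (auto simp: slice_point_def)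
qed

lemma val_slice_point:
  assumes "v \<in> insert (0, 1) V"
  shows "val (slice_point y) v =
    (if contract_vertex v = (0, 1) then 1 else y (numbering (contract_vertex v)))"
proof (cases "v = (0, 1)")
  case True
  then show ?thesis using contract_vertex_path[of 0] path_0 by simp
next
  case False
  then show ?thesis using assms by (simp add: slice_point_def Let_def)
qed

text \<open>
  Contraction identifies exactly the variables that the equations of the slice equate, so a
  solution of these equations is determined by its values at the free vertices.
\<close>

lemma slice_point_eqI:
  assumes b: "b \<in> torus V" and y: "\<And>v. v \<in> free_vertices \<Longrightarrow> y (numbering v) = b v"
    and eq: "\<And>m. m \<in> first_levels \<Longrightarrow> val b (bpath (Suc m)) = val b (bpath m)"
  shows "slice_point y = b"
proof
  fix v
  show "slice_point y v = b v"
  proof (cases "v \<in> V")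
    case True
    have "val b (contract_vertex v) = val b v"
    proof (cases "\<exists>m. v = bpath m")
      case True
      then obtain m where m: "v = bpath m" by blast
      have "val b (bpath (contract_steps first_levels m)) = val b (bpath m)"
        by (induction m) (auto simp: eq)
      then show ?thesis by (simp add: m contract_vertex_path)
    qed (auto simp: contract_vertex_def Let_def)
    moreover have "free_vertices \<subseteq> V" by (auto simp: free_vertices_def)
    ultimately show ?thesis
      using True contract_vertex_cases[OF insertI2[OF True]] y[of "contract_vertex v"]
      by (auto simp: slice_point_def Let_def dest: subsetD)
  next
    case False
    then have "b v = undefined" using b unfolding torus_def by (intro PiE_arb)
    with False show ?thesis by (simp add: slice_point_def)
  qed
qed


section \<open>The birational equivalence\<close>

text \<open>
  The value \<open>1\<close> at the index \<open>l + 1\<close>, here and for the ratios below, leaves the levels of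
  \<open>B\<^sub>0\<close> unscaled.
\<close>

definition block_value :: "nat \<Rightarrow> (nat \<times> nat \<Rightarrow> complex) \<Rightarrow> complex" where
  "block_value p b = (if p \<le> l then F_tilde k n (B p) b else 1)"

text \<open>
  The summand of the first arrow of the boundary path in block \<open>p\<close>. It is \<open>1\<close> on the slice
  and is multiplied by the scaling factor of the block, so it recovers this factor.
\<close>

definition step_ratio :: "(nat \<times> nat \<Rightarrow> complex) \<Rightarrow> nat \<Rightarrow> complex" where
  "step_ratio a p = (if p \<le> l
     then val a (bpath (Suc (partial_sum (p - 1)))) / val a (bpath (partial_sum (p - 1))) else 1)"

definition normalize_blocks :: "(nat \<Rightarrow> complex) \<Rightarrow> nat \<times> nat \<Rightarrow> complex" where
  "normalize_blocks y =
     rescale (\<lambda>m. inverse (block_value (block_index m) (slice_point y))) (slice_point y)"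

definition to_slice :: "(nat \<times> nat \<Rightarrow> complex) \<Rightarrow> nat \<times> nat \<Rightarrow> complex" where
  "to_slice a = rescale (\<lambda>m. inverse (step_ratio a (block_index m))) a"

definition slice_coordinates :: "(nat \<times> nat \<Rightarrow> complex) \<Rightarrow> nat \<Rightarrow> complex" where
  "slice_coordinates a = restrict (\<lambda>i. to_slice a (inv_into free_vertices numbering i)) Y"

definition domain :: "(nat \<Rightarrow> complex) set" where
  "domain = {y \<in> torus Y. (\<Prod>p\<in>{1..l}. block_value p (slice_point y)) \<noteq> 0}"

abbreviation "L \<equiv> L_tilde k n l d"

lemma step_ratio_nonzero:
  assumes "a \<in> torus V" "1 \<le> p"
  shows "step_ratio a p \<noteq> 0"
proof (cases "p \<le> l")
  case True
  then have "partial_sum (p - 1) \<in> first_levels" using block_index_first_level(1)[of p] assms(2) by auto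
  from first_levels_bound[OF this] show ?thesis
    using val_nonzero[OF assms(1) path_in_vertices] by (auto simp: step_ratio_def)
qed (simp add: step_ratio_def)

lemma step_ratio_rescale:
  assumes p: "p \<in> {1..l}" and b: "b \<in> torus V" and s: "\<And>m. s m \<noteq> 0"
  shows "step_ratio (rescale s b) p = s (partial_sum (p - 1)) * step_ratio b p"
proof -
  let ?m = "partial_sum (p - 1)"
  have m: "Suc ?m < k + n" using first_levels_bound block_index_first_level(1)[OF p] by blast
  show ?thesis
    using m p s val_rescale[OF path_in_vertices[OF m], of s b]
      val_rescale[OF path_in_vertices, of ?m s b]
    by (simp add: step_ratio_def passed_levels_boundary_path prod_zero_iff)
qed

lemma block_value_rescale:
  assumes p: "p \<in> {1..l}" and s: "\<And>p. s p \<noteq> 0"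
  shows "block_value p (rescale (\<lambda>m. s (block_index m)) b) = s p * block_value p b"
proof -
  have "F_tilde k n (B p) (rescale (\<lambda>m. s (block_index m)) b) = s p * F_tilde k n (B p) b"
    using Horiz_k_n_notin_block[OF p] p s by (intro F_tilde_rescale) (auto simp: block_eq)
  then show ?thesis using p by (simp add: block_value_def)
qed

lemma L_tilde_eq: "L = {a \<in> torus V. \<forall>p\<in>{1..l}. block_value p a = 1}"
  by (auto simp: L_tilde_def block_value_def)

lemma domain_block_value:
  "y \<in> domain \<longleftrightarrow> y \<in> torus Y \<and> (\<forall>p. 1 \<le> p \<longrightarrow> block_value p (slice_point y) \<noteq> 0)"
  by (auto simp: domain_def block_value_def)

text \<open>
  Each block function is homogeneous of degree one in the factor of its block and invariant
  under the other factors, so scaling by its inverse turns its value into \<open>1\<close>.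
\<close>

lemma normalize_blocks_in_L:
  assumes y: "y \<in> domain"
  shows "normalize_blocks y \<in> L"
proof -
  let ?b = "slice_point y"
  define s where "s = (\<lambda>p. if 1 \<le> p then inverse (block_value p ?b) else 1)"
  have nz: "s p \<noteq> 0" for p
    using y by (auto simp: domain_block_value s_def)
  have eq: "normalize_blocks y = rescale (\<lambda>m. s (block_index m)) ?b"
    using block_index_ge_1 by (simp add: normalize_blocks_def s_def)
  have "normalize_blocks y \<in> torus V"
    unfolding eq using y nz by (intro rescale_in_torus slice_point_in_torus) (auto simp: domain_def)
  moreover have "block_value p (normalize_blocks y) = 1" if p: "p \<in> {1..l}" for p
    unfolding eq block_value_rescale[OF p, of s, OF nz]
    using y p by (simp add: s_def domain_block_value)
  ultimately show ?thesis by (simp add: L_tilde_eq)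
qed

lemma slice_coordinates_eqI:
  assumes "y \<in> torus Y" "to_slice a = slice_point y"
  shows "slice_coordinates a = y"
proof
  fix i
  show "slice_coordinates a i = y i"
  proof (cases "i \<in> Y")
    case True
    let ?v = "inv_into free_vertices numbering i"
    have "?v \<in> free_vertices" "numbering ?v = i"
      using True numbering_bij by (auto simp: bij_betw_def inv_into_into f_inv_into_f)
    then show ?thesis
      using True by (simp add: slice_coordinates_def assms(2) slice_point_free)
  qed (use assms in \<open>auto simp: slice_coordinates_def torus_def PiE_iff extensional_def\<close>)
qed

text \<open>
  The step ratios of a slice point are \<open>1\<close>; after normalization they are therefore the
  inverse block values, and dividing by them undoes the normalization.
\<close>

lemma slice_coordinates_normalize_blocks:
  assumes y: "y \<in> domain"
  shows "slice_coordinates (normalize_blocks y) = y"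
proof -
  let ?b = "slice_point y" and ?a = "normalize_blocks y"
  have yt: "y \<in> torus Y" using y by (simp add: domain_def)
  note b = slice_point_in_torus[OF yt]
  have nz: "block_value (block_index m) ?b \<noteq> 0" for m
    using y block_index_ge_1 by (simp add: domain_block_value)
  have "step_ratio ?a p = inverse (block_value p ?b)" if p: "1 \<le> p" for p
  proof (cases "p \<le> l")
    case True
    with p have pl: "p \<in> {1..l}" by simp
    note m = block_index_first_level[OF pl]
    have "step_ratio ?b p = 1"
      using True first_levels_bound[OF m(1)] contract_vertex_first_level[OF m(1)]
        val_slice_point[OF path_in_vertices] val_nonzero[OF b path_in_vertices]
      by (simp add: step_ratio_def)
    then show ?thesis
      unfolding normalize_blocks_def using step_ratio_rescale[OF pl b] nz m(2) by simp
  qed (simp add: step_ratio_def block_value_def)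
  then have "to_slice ?a = ?b"
    unfolding to_slice_def
    by (subst normalize_blocks_def, intro rescale_rescale_inverse[OF b])
      (use nz block_index_ge_1 in auto)
  then show ?thesis
    by (rule slice_coordinates_eqI[OF yt])
qed

text \<open>
  Dividing by the step ratios makes all of them \<open>1\<close>, which are the equations of the slice.
\<close>

lemma slice_point_slice_coordinates:
  assumes a: "a \<in> torus V"
  shows "slice_coordinates a \<in> torus Y" "slice_point (slice_coordinates a) = to_slice a"
proof -
  have nz: "inverse (step_ratio a (block_index m)) \<noteq> 0" for m
    using step_ratio_nonzero[OF a block_index_ge_1] by simp
  have b: "to_slice a \<in> torus V"
    unfolding to_slice_def using a nz by (rule rescale_in_torus)
  have "slice_coordinates a i \<noteq> 0" if "i \<in> Y" for i
  proof -
    have "inv_into free_vertices numbering i \<in> free_vertices"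
      using that numbering_bij by (auto simp: bij_betw_def inv_into_into)
    then show ?thesis
      using that torus_nonzero[OF b] by (simp add: slice_coordinates_def free_vertices_def)
  qed
  then show "slice_coordinates a \<in> torus Y"
    unfolding torus_def by (intro PiE_I) (auto simp: slice_coordinates_def)
  show "slice_point (slice_coordinates a) = to_slice a"
  proof (rule slice_point_eqI[OF b])
    fix v assume "v \<in> free_vertices"
    then show "slice_coordinates a (numbering v) = to_slice a v"
      using numbering_bij numbering_in by (simp add: slice_coordinates_def bij_betw_inv_into_left)
  next
    fix m assume "m \<in> first_levels"
    then obtain p where p: "p \<in> {1..l}" "m = partial_sum (p - 1)"
      by (force simp: first_levels_def intro: that[of "Suc _"])
    note m = block_index_first_level[OF p(1), folded p(2)]
    have "step_ratio (to_slice a) p = inverse (step_ratio a p) * step_ratio a p"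
      unfolding to_slice_def using step_ratio_rescale[OF p(1) a nz] m p(2) by simp
    also have "\<dots> = 1"
      using step_ratio_nonzero[OF a, of p] p(1) by simp
    finally show "val (to_slice a) (bpath (Suc m)) = val (to_slice a) (bpath m)"
      using p val_nonzero[OF b path_in_vertices, of m] first_levels_bound[OF m(1)]
      by (simp add: step_ratio_def)
  qed
qed

text \<open>
  On the subvariety the block values are \<open>1\<close>. Moving to the slice turns them into the inverse
  step ratios, so normalization multiplies the step ratios back.
\<close>

lemma slice_coordinates_L:
  assumes a: "a \<in> L"
  shows "slice_coordinates a \<in> domain" "normalize_blocks (slice_coordinates a) = a"
proof -
  have at: "a \<in> torus V" using a by (simp add: L_tilde_eq)
  note y = slice_point_slice_coordinates[OF at]
  define s where "s = (\<lambda>p. if 1 \<le> p then inverse (step_ratio a p) else 1)"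
  have nz: "s p \<noteq> 0" for p
    using step_ratio_nonzero[OF at, of p] by (auto simp: s_def)
  have eq: "to_slice a = rescale (\<lambda>m. s (block_index m)) a"
    using block_index_ge_1 by (simp add: to_slice_def s_def)
  have bv: "block_value p (to_slice a) = s p" if "1 \<le> p" for p
  proof (cases "p \<le> l")
    case True
    then show ?thesis
      unfolding eq using block_value_rescale[of p s a] nz that a by (simp add: L_tilde_eq)
  qed (use that in \<open>simp add: block_value_def s_def step_ratio_def\<close>)
  then show "slice_coordinates a \<in> domain"
    using nz y by (simp add: domain_block_value)
  show "normalize_blocks (slice_coordinates a) = a"
    unfolding normalize_blocks_def y(2)
    by (subst (2) eq, intro rescale_rescale_inverse[OF at])
      (use nz bv block_index_ge_1 in auto)
qed


section \<open>Regularity\<close>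

lemma arc_ends:
  assumes "\<alpha> \<in> arcs Q"
  shows "head Q \<alpha> \<in> insert (k, n + 1) V" "tail Q \<alpha> \<in> insert (0, 1) V"
  using arrow_passes_level[OF assms] k n
  by (cases "\<alpha> = Horiz k n"; force simp: quiver_def variables_def)+

lemma laurent_val_slice_point:
  assumes "v \<in> insert (0, 1) V"
  shows "laurent_function Y (\<lambda>y. val (slice_point y) v)"
    "laurent_function Y (\<lambda>y. inverse (val (slice_point y) v))"
proof -
  show "laurent_function Y (\<lambda>y. val (slice_point y) v)"
    "laurent_function Y (\<lambda>y. inverse (val (slice_point y) v))"
    unfolding val_slice_point[OF assms]
    using contract_vertex_cases[OF assms] numbering_in[of "contract_vertex v"]
    by (cases "contract_vertex v = (0, 1)";
        auto intro: laurent_function_coordinate laurent_function_inverse_coordinate)+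
qed

lemma laurent_F_tilde_slice_point:
  assumes "A \<subseteq> arcs Q"
  shows "laurent_function Y (\<lambda>y. F_tilde k n A (slice_point y))"
  unfolding F_tilde_def divide_inverse
proof (intro laurent_function_sum laurent_function_mult)
  fix \<alpha> assume "\<alpha> \<in> A"
  then have \<alpha>: "\<alpha> \<in> arcs Q" using assms by auto
  show "laurent_function Y (\<lambda>y. val (slice_point y) (head Q \<alpha>))"
    using arc_ends(1)[OF \<alpha>] laurent_val_slice_point(1)[of "head Q \<alpha>"] by auto
  show "laurent_function Y (\<lambda>y. inverse (val (slice_point y) (tail Q \<alpha>)))"
    using arc_ends(2)[OF \<alpha>] by (rule laurent_val_slice_point)
qed

lemma laurent_block_value_slice_point:
  assumes "1 \<le> p"
  shows "laurent_function Y (\<lambda>y. block_value p (slice_point y))"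
proof (cases "p \<le> l")
  case True
  then have "B p \<subseteq> arcs Q" using assms by (auto simp: block_eq)
  then show ?thesis
    using True laurent_F_tilde_slice_point by (simp add: block_value_def)
qed (simp add: block_value_def)

text \<open>
  No block function vanishes identically on the slice: where all variables are \<open>1\<close>, it
  counts the arrows of its block.
\<close>

lemma dense_open_domain: "dense_open Y (torus Y) domain"
  unfolding domain_def
proof (rule dense_open_nonvanishing)
  show "laurent_function Y (\<lambda>y. \<Prod>p\<in>{1..l}. block_value p (slice_point y))"
    by (intro laurent_function_prod laurent_block_value_slice_point) auto
  define y :: "nat \<Rightarrow> complex" where "y = restrict (\<lambda>_. 1) Y"
  show "y \<in> torus Y" by (auto simp: y_def torus_def)
  have one: "val (slice_point y) v = 1" if "v \<in> insert (0, 1) V" for v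
    using contract_vertex_cases[OF that] numbering_in[of "contract_vertex v"]
    unfolding val_slice_point[OF that] y_def by auto
  have "block_value p (slice_point y) \<noteq> 0" if p: "p \<in> {1..l}" for p
  proof -
    have arcs: "B p \<subseteq> arcs Q" using p by (auto simp: block_eq)
    have "F_tilde k n (B p) (slice_point y) = (\<Sum>\<alpha>\<in>B p. 1)"
      unfolding F_tilde_def
    proof (rule sum.cong[OF refl])
      fix \<alpha> assume "\<alpha> \<in> B p"
      then have "\<alpha> \<in> arcs Q" using arcs by auto
      note ends = arc_ends[OF this]
      have "val (slice_point y) (head Q \<alpha>) = 1"
        using ends(1) one[of "head Q \<alpha>"] by auto
      with one[OF ends(2)] show
        "val (slice_point y) (head Q \<alpha>) / val (slice_point y) (tail Q \<alpha>) = 1"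
        by simp
    qed
    moreover have "finite (B p)" using arcs finite_arcs by (rule finite_subset)
    ultimately show ?thesis
      using block_nonempty[OF p] p by (simp add: block_value_def)
  qed
  then show "(\<Prod>p\<in>{1..l}. block_value p (slice_point y)) \<noteq> 0"
    by (simp add: prod_zero_iff)
qed

lemma regular_normalize_blocks:
  assumes v: "v \<in> V"
  shows "regular_function Y domain (\<lambda>y. normalize_blocks y v)"
proof (rule regular_function_quotient)
  show "domain \<subseteq> torus Y" by (auto simp: domain_def)
  show "laurent_function Y (\<lambda>y. val (slice_point y) v)"
    using v by (intro laurent_val_slice_point) auto
  show "laurent_function Y (\<lambda>y. \<Prod>m\<in>passed v. block_value (block_index m) (slice_point y))"
    by (intro laurent_function_prod laurent_block_value_slice_point block_index_ge_1)
  show "(\<Prod>m\<in>passed v. block_value (block_index m) (slice_point y)) \<noteq> 0" if "y \<in> domain" for y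
    using that block_index_ge_1 by (simp add: domain_block_value prod_zero_iff)
  show "normalize_blocks y v =
      val (slice_point y) v / (\<Prod>m\<in>passed v. block_value (block_index m) (slice_point y))" for y
    using v by (simp add: normalize_blocks_def rescale_def divide_inverse
        prod_inversef[unfolded o_def])
qed

lemma laurent_val:
  assumes "v \<in> insert (0, 1) V"
  shows "laurent_function V (\<lambda>a. val a v)" "laurent_function V (\<lambda>a. inverse (val a v))"
  using assms by (auto intro: laurent_function_coordinate laurent_function_inverse_coordinate)

lemma regular_slice_coordinates:
  assumes i: "i \<in> Y"
  shows "regular_function V L (\<lambda>a. slice_coordinates a i)"
proof (rule regular_function_laurent)
  show "L \<subseteq> torus V" by (auto simp: L_tilde_eq)
  let ?v = "inv_into free_vertices numbering i"
  have v: "?v \<in> V"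
    using i numbering_bij inv_into_into[of i numbering free_vertices]
    by (auto simp: bij_betw_def free_vertices_def)
  have ratio: "laurent_function V (\<lambda>a. inverse (step_ratio a p))" if "1 \<le> p" for p
  proof (cases "p \<le> l")
    case True
    then have "p \<in> {1..l}" using that by simp
    from first_levels_bound[OF block_index_first_level(1)[OF this]] True show ?thesis
      by (auto simp: step_ratio_def divide_inverse
          intro!: laurent_function_mult laurent_val path_in_vertices)
  qed (simp add: step_ratio_def)
  have "laurent_function V (\<lambda>a. a ?v * (\<Prod>m\<in>passed ?v. inverse (step_ratio a (block_index m))))"
    using v by (intro laurent_function_mult laurent_function_prod laurent_function_coordinate
        ratio block_index_ge_1)
  then show "laurent_function V (\<lambda>a. slice_coordinates a i)"
    using i v by (simp add: slice_coordinates_def to_slice_def rescale_def)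
qed

text \<open>
  The inverse \<open>slice_coordinates\<close> is defined on the entire subvariety, which therefore serves
  as the dense open subset of itself.
\<close>

lemma birational_normalize_blocks:
  "birational_equivalence Y (torus Y) V L domain normalize_blocks"
proof -
  have "L \<subseteq> torus V" by (auto simp: L_tilde_eq)
  then show ?thesis
    unfolding birational_equivalence_def
    using dense_open_domain dense_open_self[of L V]
      normalize_blocks_in_L regular_normalize_blocks slice_coordinates_L
      regular_slice_coordinates slice_coordinates_normalize_blocks
    by (intro conjI exI[of _ L] exI[of _ slice_coordinates]) (auto simp: regular_map_def)
qed

text \<open>
  Normalization does not affect the arrows of \<open>B\<^sub>0\<close> inside the
  grid, since their levels lie in no block. The remaining arrow contributes the inverse of
  the variable at \<open>(k, n)\<close>; there the inverse block values are inverted once more, so that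
  no denominators other than variables occur.
\<close>

lemma F_complement_normalize_blocks:
  assumes y: "y \<in> domain"
  shows "F_tilde k n (B\<^sub>0 k n l d) (normalize_blocks y) =
    F_tilde k n (B\<^sub>0 k n l d - {Horiz k n}) (slice_point y) +
    inverse (val (slice_point y) (k, n)) *
      (\<Prod>m\<in>passed (k, n). block_value (block_index m) (slice_point y))"
proof -
  let ?A = "B\<^sub>0 k n l d - {Horiz k n}" and ?b = "slice_point y" and ?a = "normalize_blocks y"
  have fin: "finite (B\<^sub>0 k n l d)"
    using finite_arcs by (auto simp: complement_block_eq)
  have h: "Horiz k n \<in> B\<^sub>0 k n l d"
    using block_index_last_level k n by (auto simp: complement_block_eq quiver_def)
  have nz: "block_value (block_index m) ?b \<noteq> 0" for m
    using y block_index_ge_1 by (simp add: domain_block_value)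
  have "F_tilde k n (B\<^sub>0 k n l d) ?a =
      val ?a (head Q (Horiz k n)) / val ?a (tail Q (Horiz k n)) + F_tilde k n ?A ?a"
    unfolding F_tilde_def by (rule sum.remove[OF fin h])
  also have "F_tilde k n ?A ?a = 1 * F_tilde k n ?A ?b"
    unfolding normalize_blocks_def
    using nz by (intro F_tilde_rescale) (auto simp: complement_block_eq block_value_def)
  also have "val ?a (head Q (Horiz k n)) / val ?a (tail Q (Horiz k n)) = inverse (val ?a (k, n))"
    by (simp add: quiver_def divide_inverse)
  also have "val ?a (k, n) = val ?b (k, n) * inverse (\<Prod>m\<in>passed (k, n). block_value (block_index m) ?b)"
    unfolding normalize_blocks_def
    using k n by (subst val_rescale) (auto simp: variables_def prod_inversef[unfolded o_def])
  finally show ?thesis by simp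
qed

lemma laurent_F_complement:
  "laurent_function Y (\<lambda>y. F_tilde k n (B\<^sub>0 k n l d - {Horiz k n}) (slice_point y) +
    inverse (val (slice_point y) (k, n)) *
      (\<Prod>m\<in>passed (k, n). block_value (block_index m) (slice_point y)))"
  using k n
  by (intro laurent_function_add laurent_function_mult laurent_function_prod
      laurent_F_tilde_slice_point laurent_val_slice_point laurent_block_value_slice_point
      block_index_ge_1) (auto simp: complement_block_eq variables_def)

end


theorem theorem2:
  fixes k n l :: nat and d :: "nat \<Rightarrow> nat"
  assumes "k \<ge> 2" and "n \<ge> 2" and "l \<ge> 1"
    and "\<And>i. i \<in> {1..l} \<Longrightarrow> d i > 0"
    and "(\<Sum>i=1..l. d i) < n + k"
  shows "\<exists>U \<tau>.
    birational_equivalence {1..n*k-l} (torus {1..n*k-l}) (variables k n) (L_tilde k n l d) U \<tau> \<and>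
    (\<exists>G. (\<forall>y\<in>U. F_tilde k n (B\<^sub>0 k n l d) (\<tau> y) = G y) \<and>
         regular_function {1..n*k-l} (torus {1..n*k-l}) G \<and>
         (\<exists>p\<in>laurent_polys {1..n*k-l}. \<forall>y\<in>torus {1..n*k-l}. G y = laurent_eval p y))"
proof -
  interpret consecutive_blocks k n l d
    using assms by unfold_locales auto
  show ?thesis
    unfolding laurent_function_def[symmetric]
    by (intro exI conjI ballI)
      (rule birational_normalize_blocks F_complement_normalize_blocks laurent_F_complement
        regular_function_laurent[OF subset_refl laurent_F_complement] | assumption)+
qed

end
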